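(* Let $(P_n)_{n\ge1}$ and $(Q_n)_{n\ge1}$ be the sequences of polynomials in $\mathbb{R}[t]$ defined by $P_1(t)=1-t^2$, $Q_1(t)=1$ and, for $n\ge1$, $$Q_{n+1}(t)=\prod_{k=1}^n P_k(t),\qquad P_{n+1}(t)=P_n^2(t)-t^2Q_n^2(t).$$ Then, for any $n\ge1$, the roots of $P_n$ and $Q_n$ are real and simple. Moreover, for any $n\ge 1$, $P_{n+1}$ has exactly $2^n$ positive zeros and $Q_{n+1}$ has exactly $2^n-1$ positive zeros, and if these are $p_1^{(n+1)}<\cdots<p_{2^n}^{(n+1)}$ and $q_1^{(n+1)}<\cdots<q_{2^n-1}^{(n+1)}$ respectively, then $$p_1^{(n+1)}<q_1^{(n+1)}<p_2^{(n+1)}<q_2^{(n+1)}<\cdots<p_{2^n-1}^{(n+1)}<q_{2^n-1}^{(n+1)}<p_{2^n}^{(n+1)}.$$ *)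

theory Defs
  imports Complex_Main "HOL-Computational_Algebra.Polynomial"
begin

text \<open>
  The roots of a real polynomial are taken in the complex numbers, so that their being real is
  a genuine claim.  No nonzeroness assumption is needed: for \<open>p = 0\<close> every complex number is a root,
  so the predicate is false.
\<close>

definition roots_real_and_simple :: "real poly \<Rightarrow> bool" where
  "roots_real_and_simple p \<longleftrightarrow>
     (\<forall>z::complex. poly (map_poly complex_of_real p) z = 0 \<longrightarrow>
        z \<in> \<real> \<and> order z (map_poly complex_of_real p) = 1)"

definition positive_zeros :: "real poly \<Rightarrow> real set" where
  "positive_zeros p = {x. 0 < x \<and> poly p x = 0}"

definition increasing_enumeration :: "nat \<Rightarrow> (nat \<Rightarrow> real) \<Rightarrow> real set \<Rightarrow> bool" where
  "increasing_enumeration m x A \<longleftrightarrow> strict_mono_on {1..m} x \<and> x ` {1..m} = A"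

end

theory Submission
  imports Defs
begin

text \<open>
  Put \<open>R n = P n / (t * Q n)\<close>.  Since \<open>Q (n + 1) = P n * Q n\<close>, the recursion says
  \<open>R (n + 1) = R n - 1 / R n\<close>, and \<open>R 1 = - (t - 1 / t)\<close>.  With Boole's map \<open>\<phi> t = t - 1 / t\<close>,
  which is odd, \<open>R n\<close> is therefore minus the \<open>n\<close>-fold iterate of \<open>\<phi>\<close>: the zeros of \<open>P n\<close> are the
  \<open>n\<close>-th preimages of \<open>0\<close> under \<open>\<phi>\<close>, and those of \<open>t * Q n\<close> are its \<open>k\<close>-th preimages with \<open>k < n\<close>.

  The map \<open>\<phi>\<close> has two increasing inverse branches, from the real line onto the positive and
  onto the negative reals.  If all zeros of \<open>P n\<close> and \<open>t * Q n\<close>, listed in increasing order, are of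
  the two kinds alternately, then the image of this list under the negative branch, followed by
  \<open>0\<close>, followed by its image under the positive branch, is again increasing and alternating, and it
  consists of zeros of \<open>P (n + 1)\<close> and \<open>t * Q (n + 1)\<close> (lemma \<open>alternating_chain_step\<close>; the algebra
  behind it is \<open>Boole_functional_equation\<close>).  The list for \<open>n = 1\<close> is \<open>-1, 0, 1\<close>.  Thus \<open>P n\<close> has
  \<open>2 ^ n\<close> and \<open>Q n\<close> has \<open>2 ^ n - 2\<close> distinct real zeros.  These numbers bound the degrees,
  so there are no other zeros, not even complex ones, and all of them are simple.  The positive
  zeros are the ones in the second half of the list.
\<close>

section \<open>Polynomials with as many real zeros as their degree\<close>

lemma poly_map_poly_of_real:
  "poly (map_poly complex_of_real p) (complex_of_real x) = complex_of_real (poly p x)"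
  by (simp add: poly_altdef degree_map_poly coeff_map_poly)

text \<open>
  The orders of all complex roots add up to at most the degree, and the elements of \<open>A\<close> already
  use up the degree with order one each: there is room neither for another root nor for a higher
  order.
\<close>

lemma full_set_of_real_zeros:
  fixes p :: "real poly"
  assumes "p \<noteq> 0" "finite A" "\<And>x. x \<in> A \<Longrightarrow> poly p x = 0" "degree p \<le> card A"
  shows "roots_real_and_simple p" "{x. poly p x = 0} = A"
proof -
  define q where "q = map_poly complex_of_real p"
  define B where "B = complex_of_real ` A"
  have q0: "q \<noteq> 0" using \<open>p \<noteq> 0\<close> by (simp add: q_def map_poly_eq_0_iff)
  have deg: "degree q = degree p" by (simp add: q_def degree_map_poly)
  have cardB: "card B = card A" unfolding B_def by (rule card_image) (simp add: inj_on_def)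
  have BR: "B \<subseteq> {z. poly q z = 0}"
    using assms(3) by (auto simp: B_def q_def poly_map_poly_of_real)
  have fin: "finite {z. poly q z = 0}" by (rule poly_roots_finite[OF q0])
  have pos: "1 \<le> order z q" if "poly q z = 0" for z
    using that q0 by (simp add: order_root Suc_le_eq)
  have root: "z \<in> B \<and> order z q = 1" if z: "poly q z = 0" for z
  proof -
    have "(\<Sum>w | poly q w = 0. order w q) \<le> card B"
      using sum_order_le_degree[OF q0] assms(4) deg cardB by linarith
    moreover have "(\<Sum>w | poly q w = 0. order w q) =
        order z q + (\<Sum>w \<in> {w. poly q w = 0} - {z}. order w q)"
      using z fin by (simp add: sum.remove)
    moreover have "card (B - {z}) \<le> (\<Sum>w \<in> {w. poly q w = 0} - {z}. order w q)"
    proof -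
      have "card (B - {z}) \<le> card ({w. poly q w = 0} - {z})"
        using fin BR by (intro card_mono) auto
      also have "\<dots> = (\<Sum>w \<in> {w. poly q w = 0} - {z}. 1)" by simp
      also have "\<dots> \<le> (\<Sum>w \<in> {w. poly q w = 0} - {z}. order w q)"
        using pos by (intro sum_mono) auto
      finally show ?thesis .
    qed
    ultimately have "order z q + card (B - {z}) \<le> card B" by linarith
    moreover have "finite B" using assms(2) by (simp add: B_def)
    ultimately show ?thesis
      using pos[OF z] by (cases "z \<in> B") (auto simp: card_Diff_singleton)
  qed
  have "B \<subseteq> \<real>" by (auto simp: B_def)
  then show "roots_real_and_simple p"
    unfolding roots_real_and_simple_def q_def[symmetric] using root by blast
  show "{x. poly p x = 0} = A"
  proof (intro equalityI subsetI)
    fix x assume "x \<in> {x. poly p x = 0}"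
    then have "complex_of_real x \<in> B"
      by (intro conjunct1[OF root]) (simp add: q_def poly_map_poly_of_real)
    then show "x \<in> A" by (auto simp: B_def)
  qed (use assms(3) in auto)
qed

section \<open>Increasing enumerations\<close>

text \<open>
  Listing the values in order gives a strictly sorted list with set \<open>A\<close>, and there is only one such
  list.
\<close>

lemma increasing_enumeration_unique:
  assumes "increasing_enumeration m x A" "increasing_enumeration m y A" "i \<in> {1..m}"
  shows "x i = y i"
proof -
  have *: "sorted (map z [1..<Suc m]) \<and> distinct (map z [1..<Suc m]) \<and>
      set (map z [1..<Suc m]) = A"
    if "increasing_enumeration m z A" for z
  proof -
    have z: "strict_mono_on {1..m} z" "z ` {1..m} = A"
      using that by (auto simp: increasing_enumeration_def)
    have "sorted (map z [1..<Suc m])"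
      unfolding sorted_map
      by (rule sorted_wrt_mono_rel[OF _ sorted_upt])
         (use z(1) in \<open>auto simp: strict_mono_on_leD\<close>)
    moreover have "distinct (map z [1..<Suc m])"
      using strict_mono_on_imp_inj_on[OF z(1)]
      by (simp add: distinct_map atLeastLessThanSuc_atLeastAtMost del: upt_Suc)
    ultimately show ?thesis
      using z(2) by (simp add: atLeastLessThanSuc_atLeastAtMost del: upt_Suc)
  qed
  have "map x [1..<Suc m] = map y [1..<Suc m]"
    using *[OF assms(1)] *[OF assms(2)] by (intro sorted_distinct_set_unique) auto
  then show ?thesis using assms(3) by (auto simp del: upt_Suc)
qed

lemma card_increasing_enumeration:
  assumes "increasing_enumeration m x A"
  shows "card A = m"
  using assms card_image[OF strict_mono_on_imp_inj_on, of "{1..m}" x]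
  by (auto simp: increasing_enumeration_def)

section \<open>The inverse branches of Boole's map\<close>

definition pos_branch :: "real \<Rightarrow> real" where
  "pos_branch y = (y + sqrt (y\<^sup>2 + 4)) / 2"

definition neg_branch :: "real \<Rightarrow> real" where
  "neg_branch y = (y - sqrt (y\<^sup>2 + 4)) / 2"

lemma abs_less_sqrt: "\<bar>y\<bar> < sqrt (y\<^sup>2 + 4)"
  by (rule real_less_rsqrt) simp

lemma pos_branch_pos: "pos_branch y > 0"
  using abs_less_sqrt[of y] by (simp add: pos_branch_def)

lemma neg_branch_neg: "neg_branch y < 0"
  using abs_less_sqrt[of y] by (simp add: neg_branch_def)

lemma Boole_pos_branch: "pos_branch y - 1 / pos_branch y = y"
proof -
  have "pos_branch y * pos_branch y - 1 = y * pos_branch y"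
    by (simp add: pos_branch_def field_simps power2_eq_square)
  then show ?thesis using pos_branch_pos[of y] by (simp add: field_simps)
qed

lemma Boole_neg_branch: "neg_branch y - 1 / neg_branch y = y"
proof -
  have "neg_branch y * neg_branch y - 1 = y * neg_branch y"
    by (simp add: neg_branch_def field_simps power2_eq_square)
  then show ?thesis using neg_branch_neg[of y] by (simp add: field_simps)
qed

text \<open>An inverse of an increasing function is increasing.\<close>

lemma pos_branch_less: "y < z \<Longrightarrow> pos_branch y < pos_branch z"
proof (rule ccontr)
  assume "y < z" "\<not> pos_branch y < pos_branch z"
  then have "1 / pos_branch y \<le> 1 / pos_branch z"
    using pos_branch_pos by (simp add: frac_le)
  then show False
    using Boole_pos_branch[of y] Boole_pos_branch[of z] \<open>y < z\<close> \<open>\<not> pos_branch y < pos_branch z\<close>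
    by linarith
qed

lemma neg_branch_less: "y < z \<Longrightarrow> neg_branch y < neg_branch z"
proof (rule ccontr)
  assume "y < z" "\<not> neg_branch y < neg_branch z"
  then have "1 / neg_branch y \<le> 1 / neg_branch z"
    using le_imp_inverse_le_neg[of "neg_branch z" "neg_branch y"] neg_branch_neg[of y]
    by (simp add: inverse_eq_divide)
  then show False
    using Boole_neg_branch[of y] Boole_neg_branch[of z] \<open>y < z\<close> \<open>\<not> neg_branch y < neg_branch z\<close>
    by linarith
qed

section \<open>Alternating chains of zeros\<close>

text \<open>
  An increasing list of \<open>2 * m - 1\<close> reals with middle entry \<open>0\<close>, alternately zeros of \<open>p\<close> and of
  \<open>t * q\<close>.  Counting from one puts the zeros of \<open>p\<close> at the odd positions; the middle position
  \<open>m\<close> is even in all applications, and \<open>0\<close> is there as the zero of the factor \<open>t\<close>.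
\<close>

definition alternating_chain :: "nat \<Rightarrow> real poly \<Rightarrow> real poly \<Rightarrow> (nat \<Rightarrow> real) \<Rightarrow> bool" where
  "alternating_chain m p q e \<longleftrightarrow>
     strict_mono_on {1..<2 * m} e \<and> e m = 0 \<and>
     (\<forall>i \<in> {1..<2 * m}. if odd i then poly p (e i) = 0 else e i * poly q (e i) = 0)"

lemma alternating_chain_less:
  "alternating_chain m p q e \<Longrightarrow> 1 \<le> i \<Longrightarrow> i < j \<Longrightarrow> j < 2 * m \<Longrightarrow> e i < e j"
  by (auto simp: alternating_chain_def strict_mono_on_def)

text \<open>
  The chain provides \<open>2 * l\<close> zeros of \<open>p\<close> and, once the entry \<open>0\<close> is discarded, which may be due to
  the factor \<open>t\<close> alone, \<open>2 * l - 2\<close> zeros of \<open>q\<close>.  That is all the degrees allow.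
\<close>

lemma alternating_chain_zeros:
  assumes chain: "alternating_chain (2 * l) p q e" and "l \<ge> 1"
    and deg: "degree p \<le> 2 * l" "degree q \<le> 2 * l - 2"
    and nz: "p \<noteq> 0" "q \<noteq> 0"
  shows "roots_real_and_simple p" "roots_real_and_simple q"
    "{x. poly p x = 0} = (\<lambda>k. e (2 * k - 1)) ` {1..2 * l}"
    "{x. poly q x = 0} = (\<lambda>k. e (2 * k)) ` ({1..<2 * l} - {l})"
proof -
  have less: "e i < e j" if "1 \<le> i" "i < j" "j < 4 * l" for i j
    using alternating_chain_less[OF chain] that by simp
  then have inj: "i = j" if "e i = e j" "1 \<le> i" "1 \<le> j" "i < 4 * l" "j < 4 * l" for i j
    using that by (metis less_irrefl nat_neq_iff)
  have mid: "e (2 * l) = 0" using chain by (simp add: alternating_chain_def)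
  have "card ((\<lambda>k. e (2 * k - 1)) ` {1..2 * l}) = card {1..2 * l}"
    by (intro card_image inj_onI) (use inj in fastforce)
  then have cp: "card ((\<lambda>k. e (2 * k - 1)) ` {1..2 * l}) = 2 * l" by simp
  have "card ((\<lambda>k. e (2 * k)) ` ({1..<2 * l} - {l})) = card ({1..<2 * l} - {l})"
    by (intro card_image inj_onI) (use inj in fastforce)
  then have cq: "card ((\<lambda>k. e (2 * k)) ` ({1..<2 * l} - {l})) = 2 * l - 2"
    using \<open>l \<ge> 1\<close> by simp
  have zp: "poly p x = 0" if "x \<in> (\<lambda>k. e (2 * k - 1)) ` {1..2 * l}" for x
  proof -
    from that obtain k where "k \<in> {1..2 * l}" "x = e (2 * k - 1)" by blast
    then show ?thesis
      using chain by (auto simp: alternating_chain_def dest!: bspec[of _ _ "2 * k - 1"])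
  qed
  have zq: "poly q x = 0" if "x \<in> (\<lambda>k. e (2 * k)) ` ({1..<2 * l} - {l})" for x
  proof -
    from that obtain k where k: "k \<in> {1..<2 * l}" "k \<noteq> l" "x = e (2 * k)" by blast
    then have "x * poly q x = 0"
      using chain by (auto simp: alternating_chain_def dest!: bspec[of _ _ "2 * k"])
    moreover have "x \<noteq> 0"
      using inj[of "2 * k" "2 * l"] k mid by auto
    ultimately show ?thesis by simp
  qed
  show "roots_real_and_simple p" "{x. poly p x = 0} = (\<lambda>k. e (2 * k - 1)) ` {1..2 * l}"
    using full_set_of_real_zeros[of p "(\<lambda>k. e (2 * k - 1)) ` {1..2 * l}", OF nz(1) _ zp] deg(1) cp
    by simp_all
  show "roots_real_and_simple q"
    "{x. poly q x = 0} = (\<lambda>k. e (2 * k)) ` ({1..<2 * l} - {l})"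
    using full_set_of_real_zeros[of q "(\<lambda>k. e (2 * k)) ` ({1..<2 * l} - {l})", OF nz(2) _ zq]
      deg(2) cq
    by simp_all
qed

text \<open>
  The chain increases through \<open>0\<close> at its middle, so its positive entries are those after it.
\<close>

lemma alternating_chain_positive_zeros:
  assumes chain: "alternating_chain (2 * l) p q e" and "l \<ge> 1"
    and deg: "degree p \<le> 2 * l" "degree q \<le> 2 * l - 2"
    and nz: "p \<noteq> 0" "q \<noteq> 0"
  shows "increasing_enumeration l (\<lambda>k. e (2 * (l + k) - 1)) (positive_zeros p)"
    "increasing_enumeration (l - 1) (\<lambda>k. e (2 * (l + k))) (positive_zeros q)"
proof -
  have less: "e i < e j" if "1 \<le> i" "i < j" "j < 4 * l" for i j
    using alternating_chain_less[OF chain] that by simp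
  have "e (2 * l) = 0" using chain by (simp add: alternating_chain_def)
  then have pos: "0 < e i \<longleftrightarrow> 2 * l < i" if "1 \<le> i" "i < 4 * l" for i
    using less[of i "2 * l"] less[of "2 * l" i] that \<open>l \<ge> 1\<close>
    by (cases i "2 * l" rule: linorder_cases) auto
  note zeros = alternating_chain_zeros[OF assms]
  have "positive_zeros p = {x \<in> {x. poly p x = 0}. 0 < x}"
    by (auto simp: positive_zeros_def)
  also have "\<dots> = (\<lambda>k. e (2 * k - 1)) ` {k \<in> {1..2 * l}. 0 < e (2 * k - 1)}"
    unfolding zeros by auto
  also have "{k \<in> {1..2 * l}. 0 < e (2 * k - 1)} = {l + 1..l + l}"
    using pos by auto
  also have "\<dots> = (\<lambda>k. l + k) ` {1..l}" by simp
  finally have P: "positive_zeros p = (\<lambda>k. e (2 * (l + k) - 1)) ` {1..l}"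
    by (simp only: image_image)
  have "positive_zeros q = {x \<in> {x. poly q x = 0}. 0 < x}"
    by (auto simp: positive_zeros_def)
  also have "\<dots> = (\<lambda>k. e (2 * k)) ` {k \<in> {1..<2 * l} - {l}. 0 < e (2 * k)}"
    unfolding zeros by auto
  also have "{k \<in> {1..<2 * l} - {l}. 0 < e (2 * k)} = {l + 1..l + (l - 1)}"
    using pos by auto
  also have "\<dots> = (\<lambda>k. l + k) ` {1..l - 1}" by simp
  finally have Q: "positive_zeros q = (\<lambda>k. e (2 * (l + k))) ` {1..l - 1}"
    by (simp only: image_image)
  show "increasing_enumeration l (\<lambda>k. e (2 * (l + k) - 1)) (positive_zeros p)"
    unfolding increasing_enumeration_def P by (auto intro!: strict_mono_onI less)
  show "increasing_enumeration (l - 1) (\<lambda>k. e (2 * (l + k))) (positive_zeros q)"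
    unfolding increasing_enumeration_def Q by (auto intro!: strict_mono_onI less)
qed

text \<open>
  The double of a chain along the two inverse branches.  The middle position \<open>2 * m\<close> is even,
  so the shift by \<open>2 * m\<close> keeps the parity that tells the two kinds of zeros apart.
\<close>

definition double_chain :: "nat \<Rightarrow> (nat \<Rightarrow> real) \<Rightarrow> nat \<Rightarrow> real" where
  "double_chain m e i =
     (if i < 2 * m then neg_branch (e i)
      else if i = 2 * m then 0
      else pos_branch (e (i - 2 * m)))"

text \<open>
  Each branch is increasing, so each half of the doubled chain is; the negative half lies below
  \<open>0\<close> and the positive half above.  The branches invert \<open>t \<mapsto> t - 1 / t\<close>, so they
  carry zeros of the old pair to zeros of the new one.
\<close>

lemma alternating_chain_double:
  assumes chain: "alternating_chain m p q e"
    and p: "\<And>t. t \<noteq> 0 \<Longrightarrow> poly p (t - 1 / t) = 0 \<Longrightarrow> poly p' t = 0"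
    and q: "\<And>t. t \<noteq> 0 \<Longrightarrow> (t - 1 / t) * poly q (t - 1 / t) = 0 \<Longrightarrow> t * poly q' t = 0"
  shows "alternating_chain (2 * m) p' q' (double_chain m e)"
proof -
  have "double_chain m e i < double_chain m e j" if "1 \<le> i" "i < j" "j < 4 * m" for i j
    using that alternating_chain_less[OF chain, of i j]
      alternating_chain_less[OF chain, of "i - 2 * m" "j - 2 * m"]
      pos_branch_pos neg_branch_neg less_trans[OF neg_branch_neg pos_branch_pos]
    by (auto simp: double_chain_def intro!: pos_branch_less neg_branch_less)
  then have "strict_mono_on {1..<2 * (2 * m)} (double_chain m e)"
    by (auto intro!: strict_mono_onI)
  moreover have "if odd i then poly p' (double_chain m e i) = 0
      else double_chain m e i * poly q' (double_chain m e i) = 0" if "i \<in> {1..<2 * (2 * m)}" for i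
  proof -
    have old: "if odd j then poly p (e j) = 0 else e j * poly q (e j) = 0"
      if "1 \<le> j" "j < 2 * m" for j
      using chain that by (simp add: alternating_chain_def)
    have lift: "if odd j then poly p' t = 0 else t * poly q' t = 0"
      if "1 \<le> j" "j < 2 * m" "t \<noteq> 0" "t - 1 / t = e j" for j t
      using old[of j] p[of t] q[of t] that by (cases "odd j") simp_all
    consider "i < 2 * m" | "i = 2 * m" | "i > 2 * m" by linarith
    then show ?thesis
    proof cases
      case 1
      then show ?thesis
        using lift[of i "neg_branch (e i)"] that neg_branch_neg[of "e i"]
          Boole_neg_branch[of "e i"]
        by (simp add: double_chain_def)
    next
      case 2
      then show ?thesis by (simp add: double_chain_def)
    next
      case 3
      then show ?thesis
        using lift[of "i - 2 * m" "pos_branch (e (i - 2 * m))"] that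
          pos_branch_pos[of "e (i - 2 * m)"] Boole_pos_branch[of "e (i - 2 * m)"]
        by (simp add: double_chain_def)
    qed
  qed
  moreover have "double_chain m e (2 * m) = 0" by (simp add: double_chain_def)
  ultimately show ?thesis unfolding alternating_chain_def by blast
qed

section \<open>The polynomial sequences\<close>

locale Boole_polynomials =
  fixes P Q :: "nat \<Rightarrow> real poly"
  assumes P_1: "P 1 = 1 - monom 1 2"
    and Q_1: "Q 1 = 1"
    and Q_Suc: "n \<ge> 1 \<Longrightarrow> Q (Suc n) = P n * Q n"
    and P_Suc: "n \<ge> 1 \<Longrightarrow> P (Suc n) = (P n)\<^sup>2 - monom 1 2 * (Q n)\<^sup>2"
begin

lemma poly_P_Suc: "n \<ge> 1 \<Longrightarrow> poly (P (Suc n)) t = (poly (P n) t)\<^sup>2 - (t * poly (Q n) t)\<^sup>2"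
  by (simp add: P_Suc poly_monom power_mult_distrib)

lemma poly_Q_Suc: "n \<ge> 1 \<Longrightarrow> poly (Q (Suc n)) t = poly (P n) t * poly (Q n) t"
  by (simp add: Q_Suc)

text \<open>
  Up to a common factor, evaluating the pair \<open>(P, t * Q)\<close> at \<open>\<phi> t\<close> moves one step along the
  sequence, because \<open>P / (t * Q)\<close> is minus an iterate of \<open>\<phi>\<close>.  The factor is \<open>- t\<^sup>2\<close> for \<open>n = 1\<close>,
  and it is squared at each step, as the recursion is homogeneous of degree two in the pair.
\<close>

lemma Boole_functional_equation:
  assumes "n \<ge> 1" "t \<noteq> 0"
  shows "\<exists>c. poly (P (Suc n)) t = c * poly (P n) (t - 1 / t) \<and>
    t * poly (Q (Suc n)) t = c * ((t - 1 / t) * poly (Q n) (t - 1 / t))"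
  using assms(1)
proof (induction n rule: nat_induct_at_least)
  case base
  have P1: "poly (P (Suc 0)) x = 1 - x\<^sup>2" for x
    using P_1 by (simp add: poly_monom)
  have Q1: "Q (Suc 0) = 1" using Q_1 by simp
  have "t * (t - 1 / t) = t\<^sup>2 - 1" using \<open>t \<noteq> 0\<close> by (simp add: field_simps power2_eq_square)
  then have "(1 - t\<^sup>2)\<^sup>2 - t\<^sup>2 = - t\<^sup>2 * (1 - (t - 1 / t)\<^sup>2)" "t * (1 - t\<^sup>2) = - t\<^sup>2 * (t - 1 / t)"
    by algebra+
  then show ?case
    using poly_P_Suc[of 1 t] poly_Q_Suc[of 1 t] P1 Q1 by (intro exI[of _ "- t\<^sup>2"]) simp
next
  case (Suc n)
  define s where "s = t - 1 / t"
  from Suc.IH obtain c where c: "poly (P (Suc n)) t = c * poly (P n) s"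
    "t * poly (Q (Suc n)) t = c * (s * poly (Q n) s)"
    unfolding s_def by blast
  have "poly (P (Suc (Suc n))) t = c\<^sup>2 * poly (P (Suc n)) s"
    using Suc.hyps c
    by (simp add: poly_P_Suc[of "Suc n" t] poly_P_Suc[of n s] power_mult_distrib right_diff_distrib)
  moreover have "t * poly (Q (Suc (Suc n))) t = c\<^sup>2 * (s * poly (Q (Suc n)) s)"
  proof -
    have "t * poly (Q (Suc (Suc n))) t = poly (P (Suc n)) t * (t * poly (Q (Suc n)) t)"
      by (simp add: poly_Q_Suc)
    also have "\<dots> = c\<^sup>2 * (s * poly (Q (Suc n)) s)"
      unfolding c poly_Q_Suc[OF Suc.hyps, of s] by (simp add: power2_eq_square)
    finally show ?thesis .
  qed
  ultimately show ?case unfolding s_def by blast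
qed

lemma alternating_chain_step:
  assumes "n \<ge> 1" "alternating_chain (2 ^ n) (P n) (Q n) e"
  shows "alternating_chain (2 ^ Suc n) (P (Suc n)) (Q (Suc n)) (double_chain (2 ^ n) e)"
  unfolding power_Suc
proof (rule alternating_chain_double[OF assms(2)])
  fix t :: real
  assume "t \<noteq> 0"
  from Boole_functional_equation[OF \<open>n \<ge> 1\<close> this] obtain c where
    "poly (P (Suc n)) t = c * poly (P n) (t - 1 / t)"
    "t * poly (Q (Suc n)) t = c * ((t - 1 / t) * poly (Q n) (t - 1 / t))"
    by blast
  then show "poly (P n) (t - 1 / t) = 0 \<Longrightarrow> poly (P (Suc n)) t = 0"
    "(t - 1 / t) * poly (Q n) (t - 1 / t) = 0 \<Longrightarrow> t * poly (Q (Suc n)) t = 0"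
    by simp_all
qed

lemma ex_alternating_chain:
  "n \<ge> 1 \<Longrightarrow> \<exists>e. alternating_chain (2 ^ n) (P n) (Q n) e"
proof (induction n rule: nat_induct_at_least)
  case base
  have "poly (P 1) (real i - 2) = 0" if "i \<in> {1..<4}" "odd i" for i
  proof -
    have "i = 1 \<or> i = 3" using that unfolding atLeastLessThan_iff by presburger
    then show ?thesis unfolding P_1 by (auto simp: poly_monom)
  qed
  moreover have "i = 2" if "i \<in> {1..<4}" "even i" for i :: nat
    using that unfolding atLeastLessThan_iff by presburger
  ultimately have "alternating_chain (2 ^ 1) (P 1) (Q 1) (\<lambda>i. real i - 2)"
    by (auto simp: alternating_chain_def intro!: strict_mono_onI)
  then show ?case by blast
next
  case (Suc n)
  then show ?case using alternating_chain_step by blast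
qed

text \<open>
  The \<open>- 2\<close> matches the chain, which has \<open>2 ^ n - 1\<close> entries at even positions, one of them
  being \<open>0\<close>; it also keeps the term \<open>t\<^sup>2 * (Q n)\<^sup>2\<close> of the recursion within the degree of \<open>(P n)\<^sup>2\<close>.
\<close>

lemma degree_bounds:
  "n \<ge> 1 \<Longrightarrow> degree (P n) \<le> 2 ^ n \<and> degree (Q n) \<le> 2 ^ n - 2"
proof (induction n rule: nat_induct_at_least)
  case base
  have "degree (P 1) \<le> 2" unfolding P_1 by (intro degree_diff_le) (simp_all add: degree_monom_le)
  then show ?case using Q_1 by simp
next
  case (Suc n)
  have ge2: "(2::nat) \<le> 2 ^ n" using self_le_power[of 2 n] Suc.hyps by simp
  have "degree ((P n)\<^sup>2) \<le> 2 ^ Suc n"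
    using degree_power_le[of "P n" 2] Suc.IH by simp
  moreover have "degree (monom 1 2 * (Q n)\<^sup>2) \<le> 2 ^ Suc n"
    using degree_mult_le[of "monom 1 2" "(Q n)\<^sup>2"] degree_power_le[of "Q n" 2]
      degree_monom_le[of "1::real" 2] Suc.IH[THEN conjunct2] ge2
    unfolding power_Suc by linarith
  ultimately have "degree (P (Suc n)) \<le> 2 ^ Suc n"
    unfolding P_Suc[OF Suc.hyps] by (rule degree_diff_le)
  moreover have "degree (Q (Suc n)) \<le> 2 ^ Suc n - 2"
    unfolding Q_Suc[OF Suc.hyps] power_Suc
    using degree_mult_le[of "P n" "Q n"] Suc.IH[THEN conjunct1] Suc.IH[THEN conjunct2] ge2
    by linarith
  ultimately show ?case by blast
qed

text \<open>This is how the polynomials are seen to be nonzero.\<close>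

lemma poly_0_eq_1: "n \<ge> 1 \<Longrightarrow> poly (P n) 0 = 1 \<and> poly (Q n) 0 = 1"
proof (induction n rule: nat_induct_at_least)
  case base
  then show ?case unfolding P_1 Q_1 by (simp add: poly_monom)
qed (simp add: poly_P_Suc poly_Q_Suc)

lemma nonzero:
  assumes "n \<ge> 1"
  shows "P n \<noteq> 0" "Q n \<noteq> 0"
  using poly_0_eq_1[OF assms] by auto

lemma roots_real_and_simple_P_Q:
  assumes "n \<ge> 1"
  shows "roots_real_and_simple (P n)" "roots_real_and_simple (Q n)"
proof -
  from assms obtain k where n: "n = Suc k" by (cases n) auto
  from ex_alternating_chain[OF assms] obtain e
    where e: "alternating_chain (2 * 2 ^ k) (P n) (Q n) e" by (auto simp: n)
  show "roots_real_and_simple (P n)" "roots_real_and_simple (Q n)"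
    using alternating_chain_zeros(1,2)[OF e] degree_bounds[OF assms] nonzero[OF assms]
    by (simp_all add: n)
qed

lemma ex_interlacing_enumerations:
  "\<exists>p q. increasing_enumeration (2 ^ n) p (positive_zeros (P (Suc n))) \<and>
    increasing_enumeration (2 ^ n - 1) q (positive_zeros (Q (Suc n))) \<and>
    (\<forall>i \<in> {1..2 ^ n - 1}. p i < q i \<and> q i < p (i + 1))"
proof -
  from ex_alternating_chain[of "Suc n"] obtain e
    where e: "alternating_chain (2 * 2 ^ n) (P (Suc n)) (Q (Suc n)) e" by auto
  \<comment> \<open>The zeros in question are consecutive entries of the chain.\<close>
  have "e i < e j" if "1 \<le> i" "i < j" "j < 4 * 2 ^ n" for i j
    using alternating_chain_less[OF e] that by simp
  then have "\<forall>i \<in> {1..2 ^ n - 1}. e (2 * (2 ^ n + i) - 1) < e (2 * (2 ^ n + i)) \<and>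
      e (2 * (2 ^ n + i)) < e (2 * (2 ^ n + (i + 1)) - 1)"
    by auto
  then show ?thesis
    using alternating_chain_positive_zeros[OF e] degree_bounds[of "Suc n"] nonzero[of "Suc n"]
    by (intro exI conjI) auto
qed

end

theorem proposition5p3:
  fixes P Q :: "nat \<Rightarrow> real poly"
  assumes P1: "P 1 = 1 - monom 1 2"
    and Q1: "Q 1 = 1"
    and Q_rec: "\<And>n. n \<ge> 1 \<Longrightarrow> Q (n + 1) = (\<Prod>k=1..n. P k)"
    and P_rec: "\<And>n. n \<ge> 1 \<Longrightarrow> P (n + 1) = (P n)^2 - monom 1 2 * (Q n)^2"
  shows "(\<forall>n\<ge>1. roots_real_and_simple (P n) \<and> roots_real_and_simple (Q n)) \<and>
    (\<forall>n\<ge>1.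
       card (positive_zeros (P (n + 1))) = 2 ^ n \<and>
       card (positive_zeros (Q (n + 1))) = 2 ^ n - 1 \<and>
       (\<forall>p q. increasing_enumeration (2 ^ n) p (positive_zeros (P (n + 1))) \<and>
              increasing_enumeration (2 ^ n - 1) q (positive_zeros (Q (n + 1))) \<longrightarrow>
              (\<forall>i\<in>{1..2 ^ n - 1}. p i < q i \<and> q i < p (i + 1))))"
proof -
  have Q_step: "Q (Suc n) = P n * Q n" if n: "n \<ge> 1" for n
  proof (cases "n = 1")
    case True
    then show ?thesis using Q_rec[of 1] Q1 by simp
  next
    case False
    then obtain k where "n = Suc k" "k \<ge> 1" using n by (cases n) auto
    then show ?thesis using Q_rec[of k] Q_rec[of n] by (simp add: mult.commute)
  qed
  interpret Boole_polynomials P Q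
    by unfold_locales (use P1 Q1 Q_step P_rec in auto)
  have main: "card (positive_zeros (P (n + 1))) = 2 ^ n \<and>
      card (positive_zeros (Q (n + 1))) = 2 ^ n - 1 \<and>
      (\<forall>p q. increasing_enumeration (2 ^ n) p (positive_zeros (P (n + 1))) \<and>
             increasing_enumeration (2 ^ n - 1) q (positive_zeros (Q (n + 1))) \<longrightarrow>
             (\<forall>i\<in>{1..2 ^ n - 1}. p i < q i \<and> q i < p (i + 1)))" for n
  proof -
    from ex_interlacing_enumerations[of n] obtain p' q' where
      p': "increasing_enumeration (2 ^ n) p' (positive_zeros (P (n + 1)))" and
      q': "increasing_enumeration (2 ^ n - 1) q' (positive_zeros (Q (n + 1)))" and
      interlacing: "\<forall>i \<in> {1..2 ^ n - 1}. p' i < q' i \<and> q' i < p' (i + 1)"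
      by auto
    have "p i < q i \<and> q i < p (i + 1)"
      if "increasing_enumeration (2 ^ n) p (positive_zeros (P (n + 1)))"
        "increasing_enumeration (2 ^ n - 1) q (positive_zeros (Q (n + 1)))"
        "i \<in> {1..2 ^ n - 1}" for p q i
    proof -
      have "p i = p' i" "p (i + 1) = p' (i + 1)" "q i = q' i"
        using that(3) by (auto intro!: increasing_enumeration_unique[OF that(1) p']
            increasing_enumeration_unique[OF that(2) q'])
      then show ?thesis using interlacing that(3) by simp
    qed
    then show ?thesis
      using card_increasing_enumeration[OF p'] card_increasing_enumeration[OF q'] by blast
  qed
  show ?thesis using main roots_real_and_simple_P_Q by blast
qed

end
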